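(* Let $n>d\ge1$ be integers. If $\mathcal{T}$ is a maximal element of the poset $(T_{n,d},\preceq)$, then $$\mathrm{dist}_{\mathcal{T}}(C(\mathcal{T}),v)=\lfloor d/2\rfloor$$ for every leaf $v$ of $\mathcal{T}$.
   Context: Graphs are finite, simple and undirected. For a connected graph $G$, $\mathrm{dist}_G(v,w)$ is the length of a shortest path between $v$ and $w$, and for $X\subseteq V(G)$, $\mathrm{dist}_G(X,v)=\min_{w\in X}\mathrm{dist}_G(w,v)$. The eccentricity of $v$ is $e_G(v)=\max_{w\in V(G)}\mathrm{dist}_G(w,v)$ and the diameter of $G$ is $\max_v e_G(v)$. For a tree $\mathcal{T}$, a center is a vertex $c$ with $e_{\mathcal{T}}(c)=\min_{v\in V(\mathcal{T})}e_{\mathcal{T}}(v)$, and $C(\mathcal{T})$ denotes the set of centers of $\mathcal{T}$. The Wiener index $W(G)$ is the sum of $\mathrm{dist}_G(v,w)$ over all unordered pairs of vertices $v,w$. Let $T_{n,d}$ be the set of trees (considered up to isomorphism) on $n$ vertices with diameter $d$. The covering relation is defined as follows. Let $\mathcal{S}$ be a tree with two distinct vertices $i_1$ and $i_2$, and let $B$ be a tree with a vertex $k$. For $j=1,2$, form the tree $\mathcal{T}_j$ from the disjoint union of $\mathcal{S}$ and $B$ by adding an edge between $i_j$ and $k$. We say that $\mathcal{T}_1$ covers $\mathcal{T}_2$, written $\mathcal{T}_2\lessdot\mathcal{T}_1$, if $W(\mathcal{T}_2)<W(\mathcal{T}_1)$ and the diameters of $\mathcal{T}_1$ and $\mathcal{T}_2$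 are the same. The partial order on $T_{n,d}$ is: $\mathcal{T}\preceq\mathcal{T}'$ if there are $k\ge0$ and a sequence $(\mathcal{T}_0,\dots,\mathcal{T}_k)$ of elements of $T_{n,d}$ with $\mathcal{T}=\mathcal{T}_0\lessdot\mathcal{T}_1\lessdot\cdots\lessdot\mathcal{T}_k=\mathcal{T}'$. *)

theory Defs
  imports "Graph_Theory.Graph_Theory"
begin

text \<open>
  A finite simple undirected graph is a \<open>pair_graph\<close>: a finite, loop-free, symmetric digraph
  in which each edge \<open>{u, v}\<close> is represented by the two arcs \<open>(u, v)\<close> and \<open>(v, u)\<close>.

  The library's \<open>forest\<close> and \<open>tree\<close> are not suitable here: they forbid every directed cycle,
  including \<open>u, v, u\<close>, which arises from any edge of a symmetric digraph. The cycles of the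
  undirected graph are the directed cycles of length at least 3. The library's \<open>connected\<close>
  includes that the graph has at least one vertex.
\<close>

definition undirected_tree :: "'a pair_pre_digraph \<Rightarrow> bool" where
  "undirected_tree G \<longleftrightarrow>
     pair_graph G \<and> connected (with_proj G) \<and>
     \<not> (\<exists>p. pre_digraph.cycle (with_proj G) p \<and> length p \<ge> 3)"

definition leaf :: "'a pair_pre_digraph \<Rightarrow> 'a \<Rightarrow> bool" where
  "leaf G v \<longleftrightarrow> v \<in> pverts G \<and> out_degree (with_proj G) v = 1"

definition gdist :: "'a pair_pre_digraph \<Rightarrow> 'a \<Rightarrow> 'a \<Rightarrow> nat" where
  "gdist G v w = (LEAST l. \<exists>p. pre_digraph.apath (with_proj G) v p w \<and> length p = l)"

definition gsetdist :: "'a pair_pre_digraph \<Rightarrow> 'a set \<Rightarrow> 'a \<Rightarrow> nat" where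
  "gsetdist G X v = Min ((\<lambda>w. gdist G w v) ` X)"

definition eccentricity :: "'a pair_pre_digraph \<Rightarrow> 'a \<Rightarrow> nat" where
  "eccentricity G v = Max ((\<lambda>w. gdist G w v) ` pverts G)"

definition diameter :: "'a pair_pre_digraph \<Rightarrow> nat" where
  "diameter G = Max (eccentricity G ` pverts G)"

definition centers :: "'a pair_pre_digraph \<Rightarrow> 'a set" where
  "centers G = {c \<in> pverts G. eccentricity G c = Min (eccentricity G ` pverts G)}"

text \<open>
  Unordered pairs are two-element vertex sets (a pair with \<open>v = w\<close> would contribute \<open>0\<close>).
  The description is well defined because the distance in an undirected graph is symmetric.
\<close>

definition wiener_index :: "'a pair_pre_digraph \<Rightarrow> nat" where
  "wiener_index G =
     (\<Sum>e | e \<subseteq> pverts G \<and> card e = 2. THE l. \<exists>v w. e = {v, w} \<and> l = gdist G v w)"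

definition join_by_edge ::
    "'a pair_pre_digraph \<Rightarrow> 'a \<Rightarrow> 'a pair_pre_digraph \<Rightarrow> 'a \<Rightarrow> 'a pair_pre_digraph" where
  "join_by_edge S i B k =
     \<lparr> pverts = pverts S \<union> pverts B,
       parcs = parcs S \<union> parcs B \<union> {(i, k), (k, i)} \<rparr>"

text \<open>\<open>covered_by T2 T1\<close> means that \<open>T1\<close> covers \<open>T2\<close>, for concrete representatives.\<close>

definition covered_by :: "'a pair_pre_digraph \<Rightarrow> 'a pair_pre_digraph \<Rightarrow> bool" where
  "covered_by T2 T1 \<longleftrightarrow>
     (\<exists>S B i1 i2 k.
        undirected_tree S \<and> undirected_tree B \<and> pverts S \<inter> pverts B = {} \<and>
        i1 \<in> pverts S \<and> i2 \<in> pverts S \<and> i1 \<noteq> i2 \<and> k \<in> pverts B \<and>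
        T1 = join_by_edge S i1 B k \<and> T2 = join_by_edge S i2 B k) \<and>
     wiener_index T2 < wiener_index T1 \<and> diameter T1 = diameter T2"

text \<open>
  Trees up to isomorphism are isomorphism classes of trees whose vertices are drawn from \<open>'a\<close>.
  If \<open>'a\<close> has at least \<open>n\<close> elements, every isomorphism type of trees on \<open>n\<close> vertices occurs;
  otherwise there are no such trees over \<open>'a\<close>. As \<open>S\<close> and \<open>B\<close> in a covering step are subtrees
  of the two trees compared, the covering relation on classes does not depend on \<open>'a\<close> either.
\<close>

definition tree_iso :: "'a pair_pre_digraph rel" where
  "tree_iso = {(G, H). undirected_tree G \<and> undirected_tree H \<and>
                       digraph_iso (with_proj G) (with_proj H)}"

definition tree_classes :: "nat \<Rightarrow> nat \<Rightarrow> 'a pair_pre_digraph set set" where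
  "tree_classes n d =
     {T. undirected_tree T \<and> card (pverts T) = n \<and> diameter T = d} // tree_iso"

definition class_covered_by ::
    "'a pair_pre_digraph set \<Rightarrow> 'a pair_pre_digraph set \<Rightarrow> bool" where
  "class_covered_by A2 A1 \<longleftrightarrow> (\<exists>T2\<in>A2. \<exists>T1\<in>A1. covered_by T2 T1)"

definition tree_class_le ::
    "nat \<Rightarrow> nat \<Rightarrow> 'a pair_pre_digraph set \<Rightarrow> 'a pair_pre_digraph set \<Rightarrow> bool" where
  "tree_class_le n d A B \<longleftrightarrow>
     A \<in> tree_classes n d \<and> B \<in> tree_classes n d \<and>
     (\<lambda>X Y. X \<in> tree_classes n d \<and> Y \<in> tree_classes n d \<and> class_covered_by X Y)\<^sup>*\<^sup>* A B"

definition maximal_tree_class :: "nat \<Rightarrow> nat \<Rightarrow> 'a pair_pre_digraph set \<Rightarrow> bool" where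
  "maximal_tree_class n d A \<longleftrightarrow>
     A \<in> tree_classes n d \<and> (\<forall>B\<in>tree_classes n d. tree_class_le n d A B \<longrightarrow> B = A)"

lemma equiv_tree_iso:
  "equiv {T :: 'a pair_pre_digraph. undirected_tree T} tree_iso"
proof -
  have wf: "wf_digraph (with_proj T)" if "undirected_tree T" for T :: "'a pair_pre_digraph"
    using that
    by (simp add: undirected_tree_def wf_digraph_wp_iff pair_graph_def pair_digraph_def
        pair_fin_digraph_def)
  have refl: "digraph_iso (with_proj T) (with_proj T)"
    if "undirected_tree T" for T :: "'a pair_pre_digraph"
  proof -
    let ?h = "\<lparr>iso_verts = id, iso_arcs = id, iso_head = snd, iso_tail = fst\<rparr>"
    have "pre_digraph.digraph_isomorphism (with_proj T) ?h"
      using wf[OF that] by (simp add: pre_digraph.digraph_isomorphism_def)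
    moreover have "with_proj T = app_iso ?h (with_proj T)"
      by (simp add: app_iso_def with_proj_def)
    ultimately show ?thesis
      unfolding digraph_iso_def by blast
  qed
  show ?thesis
  proof (intro equivI)
    show "refl_on {T :: 'a pair_pre_digraph. undirected_tree T} tree_iso"
      by (auto simp: refl_on_def tree_iso_def intro: refl)
    show "sym (tree_iso :: 'a pair_pre_digraph rel)"
      by (auto simp: sym_def tree_iso_def intro: digraph_iso_swap[OF wf])
    show "trans (tree_iso :: 'a pair_pre_digraph rel)"
      by (auto simp: trans_def tree_iso_def intro: digraph_iso_trans)
  qed (auto simp: tree_iso_def)
qed

end

theory Submission
  imports Defs
begin

text \<open>
  Call a vertex diametral if it lies on a path of length \<open>diameter T\<close>. If some vertex of a tree
  \<open>T\<close> is not diametral, there is an edge \<open>u x\<close> with \<open>u\<close> diametral and \<open>x\<close> not. Deleting it splits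
  \<open>T\<close> into \<open>S\<close> (containing \<open>u\<close> and a diametral path through \<open>u\<close>) and \<open>B\<close> (containing \<open>x\<close>).
  The sum of distances in \<open>S\<close> is strictly convex along paths, so it increases from \<open>u\<close> to one of
  its two neighbours on the diametral path; reattaching \<open>B\<close> there increases the Wiener index.
  The diameter is unchanged, because distances between \<open>S\<close> and \<open>B\<close> were less than the diameter
  and grow by at most one. Hence every vertex of a maximal tree is diametral, so every leaf is
  an end of a diametral path, and a midpoint of that path is a nearest center.
\<close>

subsection \<open>Trees and distances in terms of the arc relation\<close>

text \<open>The link from arc lists to relation powers: afterwards distance and connectivity are
  handled through the arc relation alone.\<close>

lemma relpow_iff_pcas:
  "(u, v) \<in> R ^^ l \<longleftrightarrow> (\<exists>p. set p \<subseteq> R \<and> pcas u p v \<and> length p = l)"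
proof (induction l arbitrary: u)
  case 0
  then show ?case by auto
next
  case (Suc l)
  have "(u, v) \<in> R ^^ Suc l \<longleftrightarrow> (\<exists>w. (u, w) \<in> R \<and> (w, v) \<in> R ^^ l)"
    by (metis relpow_Suc_D2 relpow_Suc_I2)
  also have "\<dots> \<longleftrightarrow> (\<exists>p. set p \<subseteq> R \<and> pcas u p v \<and> length p = Suc l)"
  proof
    assume "\<exists>w. (u, w) \<in> R \<and> (w, v) \<in> R ^^ l"
    then obtain w p where "(u, w) \<in> R" "set p \<subseteq> R" "pcas w p v" "length p = l"
      using Suc.IH by blast
    then show "\<exists>p. set p \<subseteq> R \<and> pcas u p v \<and> length p = Suc l"
      by (intro exI[of _ "(u, w) # p"]) auto
  next
    assume "\<exists>p. set p \<subseteq> R \<and> pcas u p v \<and> length p = Suc l"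
    then show "\<exists>w. (u, w) \<in> R \<and> (w, v) \<in> R ^^ l"
      using Suc.IH by (fastforce simp: length_Suc_conv)
  qed
  finally show ?case .
qed

lemma rtrancl_iff_pcas: "(u, v) \<in> R\<^sup>* \<longleftrightarrow> (\<exists>p. set p \<subseteq> R \<and> pcas u p v)"
  by (auto simp: rtrancl_power relpow_iff_pcas)

lemma awalk_with_proj_iff:
  "pre_digraph.awalk (with_proj G) u p v \<longleftrightarrow> u \<in> pverts G \<and> set p \<subseteq> parcs G \<and> pcas u p v"
  by (simp add: pre_digraph.awalk_def cas_with_proj_eq)

lemma pawalk_verts_eq_map_snd: "pcas u p v \<Longrightarrow> pawalk_verts u p = u # map snd p"
  by (induction p arbitrary: u) auto

lemma pawalk_verts_eq_map_fst: "pcas u p v \<Longrightarrow> pawalk_verts u p = map fst p @ [v]"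
  by (induction p arbitrary: u) auto

lemma pcas_last: "pcas u p v \<Longrightarrow> p \<noteq> [] \<Longrightarrow> snd (last p) = v"
  by (induction p arbitrary: u) auto

text \<open>Cutting out the loops of a walk only removes arcs; the arcs left are distinct, so
  comparing cardinalities bounds the length.\<close>

lemma apath_of_awalk:
  assumes "pair_wf_digraph G" and "pre_digraph.awalk (with_proj G) u p v"
  obtains q where "pre_digraph.apath (with_proj G) u q v" "set q \<subseteq> set p" "length q \<le> length p"
proof -
  interpret pair_wf_digraph G by fact
  let ?q = "awalk_to_apath p"
  have ap: "apath u ?q v" by (rule apath_awalk_to_apath) (fact assms(2))
  have sub: "set ?q \<subseteq> set p" by (rule awalk_to_apath_subset) (fact assms(2))
  have "distinct ?q"
    by (rule distinct_verts_imp_distinct[of u _ v]) (use ap in \<open>auto simp: apath_def\<close>)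
  then have "length ?q \<le> length p"
    using card_mono[OF _ sub] card_length[of p] by (simp add: distinct_card)
  with ap sub show ?thesis by (rule that)
qed

lemma gdist_eq_Least:
  assumes "pair_wf_digraph G" and "v \<in> pverts G"
  shows "gdist G v w = (LEAST l. (v, w) \<in> parcs G ^^ l)"
proof -
  let ?P = "\<lambda>l. \<exists>p. pre_digraph.apath (with_proj G) v p w \<and> length p = l"
  let ?Q = "\<lambda>l. (v, w) \<in> parcs G ^^ l"
  have PQ: "?Q l" if "?P l" for l
    using that by (auto simp: relpow_iff_pcas pre_digraph.apath_def awalk_with_proj_iff)
  have QP: "\<exists>k\<le>l. ?P k" if Q: "?Q l" for l
  proof -
    obtain p where "pre_digraph.awalk (with_proj G) v p w" "length p = l"
      using Q assms(2) unfolding relpow_iff_pcas awalk_with_proj_iff by blast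
    then show ?thesis using apath_of_awalk[OF assms(1)] by metis
  qed
  show ?thesis
  proof (cases "\<exists>l. ?Q l")
    case True
    then have "?Q (LEAST l. ?Q l)" by (metis LeastI)
    then have "(LEAST l. ?P l) = (LEAST l. ?Q l)"
      by (intro Least_equality) (metis QP PQ Least_le le_antisym, metis PQ Least_le)
    then show ?thesis by (simp add: gdist_def)
  next
    case False
    \<comment> \<open>With no walk at all both predicates are constantly false, so the two
      \<open>LEAST\<close> terms coincide although their value is unspecified.\<close>
    with PQ have "?P = ?Q" by blast
    then show ?thesis by (simp only: gdist_def)
  qed
qed

lemma rtrancl_on_eq_rtrancl:
  assumes "R \<subseteq> V \<times> V" and "u \<in> V"
  shows "(u, v) \<in> rtrancl_on V R \<longleftrightarrow> (u, v) \<in> R\<^sup>*"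
proof
  assume "(u, v) \<in> R\<^sup>*"
  then show "(u, v) \<in> rtrancl_on V R"
    by induction (use assms in \<open>auto intro: rtrancl_on.intros\<close>)
qed (rule rtrancl_on_rtranclI)

lemma sym_del_edge: "sym E \<Longrightarrow> sym (E - {(u, v), (v, u)})"
  by (auto simp: sym_def)

text \<open>A detour around an edge, closed up by that edge, is a cycle, and a cycle minus one arc
  is a detour. The bridge form is easier to transport through splitting, joining and
  contracting.\<close>

lemma no_long_cycle_iff_bridges:
  assumes "pair_graph G"
  shows "(\<nexists>p. pre_digraph.cycle (with_proj G) p \<and> length p \<ge> 3) \<longleftrightarrow>
    (\<forall>u v. (u, v) \<in> parcs G \<longrightarrow> (u, v) \<notin> (parcs G - {(u, v), (v, u)})\<^sup>*)"
    (is "?L \<longleftrightarrow> ?R")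
proof -
  interpret pair_graph G by fact
  have symE: "sym (parcs G)" using pair_sym_arcs by (simp add: symmetric_def)
  show ?thesis
  proof
    assume L: ?L
    show ?R
    proof (intro allI impI notI)
      fix u v assume uv: "(u, v) \<in> parcs G" and r: "(u, v) \<in> (parcs G - {(u, v), (v, u)})\<^sup>*"
      then obtain p where p: "awalk u p v" "set p \<subseteq> parcs G - {(u, v), (v, u)}"
        by (auto simp: rtrancl_iff_pcas awalk_with_proj_iff dest: in_arcsD1)
      obtain q where q: "apath u q v" "set q \<subseteq> set p"
        by (rule apath_of_awalk[OF pair_wf_digraph p(1)])
      have "u \<noteq> v" using pair_no_loops uv by fastforce
      have "(u, v) \<notin> set q" using p(2) q(2) by blast
      \<comment> \<open>Length 0 would give \<open>u = v\<close>, and length 1 would make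
        \<open>q\<close> the deleted arc \<open>(u, v)\<close>.\<close>
      have "length q \<ge> 2"
      proof (rule ccontr)
        assume "\<not> length q \<ge> 2"
        then consider "q = []" | e where "q = [e]"
          by (cases q; cases "tl q") auto
        then show False
          using q(1) \<open>u \<noteq> v\<close> \<open>(u, v) \<notin> set q\<close>
          by cases (auto simp: apath_def awalk_with_proj_iff)
      qed
      have "(v, u) \<in> parcs G" using symE uv by (auto dest: symD)
      then have "awalk v [(v, u)] u"
        by (auto simp: awalk_with_proj_iff dest: in_arcsD1)
      then have "awalk v ([(v, u)] @ q) v"
        using q(1) by (intro awalk_appendI) (auto simp: apath_def)
      moreover have "distinct (tl (pawalk_verts v ([(v, u)] @ q)))"
        using q(1) by (simp add: apath_def)
      ultimately have "cycle ([(v, u)] @ q)"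
        unfolding cycle_def by blast
      with L \<open>length q \<ge> 2\<close> show False by fastforce
    qed
  next
    assume R: ?R
    show ?L
    proof
      assume "\<exists>p. cycle p \<and> 3 \<le> length p"
      then obtain u p where p: "awalk u p u" "distinct (tl (pawalk_verts u p))" "length p \<ge> 3"
        by (auto simp: cycle_def)
      then obtain v q where pq: "p = (u, v) # q"
        by (cases p) (auto simp: awalk_with_proj_iff)
      then have uv: "(u, v) \<in> parcs G" and q: "apath v q u" "length q \<ge> 2"
        using p by (auto simp: apath_def awalk_with_proj_iff dest: in_arcsD2)
      have pc: "pcas v q u" and dist: "distinct (pawalk_verts v q)"
        using q by (auto simp: apath_def awalk_with_proj_iff)
      \<comment> \<open>The path starts at \<open>v\<close> and never returns there, so it cannot
        contain the arc \<open>(u, v)\<close>.\<close>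
      then have "v \<notin> snd ` set q"
        by (simp add: pawalk_verts_eq_map_snd)
      \<comment> \<open>Its tail \<open>v\<close> would make it the first arc of the path and its
        head \<open>u\<close> the last, but there are at least two arcs.\<close>
      have "(v, u) \<notin> set q"
      proof
        assume "(v, u) \<in> set q"
        then obtain j where j: "j < length q" "q ! j = (v, u)"
          by (auto simp: in_set_conv_nth)
        have "fst (q ! 0) = v" using pc q(2) by (cases q) auto
        then have "map fst q ! j = map fst q ! 0" using j q(2) by (subst (1 2) nth_map) auto
        moreover have "distinct (map fst q)" using dist pc by (simp add: pawalk_verts_eq_map_fst)
        ultimately have "j = 0" using j(1) q(2)
          by (subst (asm) nth_eq_iff_index_eq) auto
        have "q \<noteq> []" using q(2) by auto
        then have "snd (last q) = u" using pc by (simp add: pcas_last)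
        then have "map snd q ! j = map snd q ! (length q - 1)"
          using j \<open>q \<noteq> []\<close> by (subst (1 2) nth_map) (auto simp: last_conv_nth)
        moreover have "distinct (map snd q)" using dist pc by (simp add: pawalk_verts_eq_map_snd)
        ultimately have "j = length q - 1" using j(1) q(2)
          by (subst (asm) nth_eq_iff_index_eq) auto
        with \<open>j = 0\<close> q(2) show False by simp
      qed
      have "(v, u) \<in> (parcs G - {(u, v), (v, u)})\<^sup>*"
        unfolding rtrancl_iff_pcas
        using q \<open>v \<notin> snd ` set q\<close> \<open>(v, u) \<notin> set q\<close>
        by (intro exI[of _ q]) (force simp: apath_def awalk_with_proj_iff)
      then have "(u, v) \<in> (parcs G - {(u, v), (v, u)})\<^sup>*"
        using sym_rtrancl[OF sym_del_edge[OF symE]] by (auto dest: symD)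
      with R uv show False by blast
    qed
  qed
qed

lemma undirected_tree_iff:
  "undirected_tree G \<longleftrightarrow>
     finite (pverts G) \<and> pverts G \<noteq> {} \<and> parcs G \<subseteq> pverts G \<times> pverts G \<and> sym (parcs G) \<and>
     (\<forall>u\<in>pverts G. \<forall>v\<in>pverts G. (u, v) \<in> (parcs G)\<^sup>*) \<and>
     (\<forall>u v. (u, v) \<in> parcs G \<longrightarrow> (u, v) \<notin> (parcs G - {(u, v), (v, u)})\<^sup>*)"
    (is "_ \<longleftrightarrow> ?R")
proof -
  have conn: "connected (with_proj G) \<longleftrightarrow>
      pverts G \<noteq> {} \<and> (\<forall>u\<in>pverts G. \<forall>v\<in>pverts G. (u, v) \<in> (parcs G)\<^sup>*)"
    if "parcs G \<subseteq> pverts G \<times> pverts G" "sym (parcs G)"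
  proof -
    have "(parcs G)\<^sup>s = parcs G"
      using that(2) by (auto simp: symcl_def dest: symD)
    then show ?thesis
      using rtrancl_on_eq_rtrancl[OF that(1)] by (simp add: connected_conv)
  qed
  have graph: "pair_graph G \<longleftrightarrow> finite (pverts G) \<and> parcs G \<subseteq> pverts G \<times> pverts G \<and>
      sym (parcs G) \<and> (\<forall>u. (u, u) \<notin> parcs G)" (is "_ \<longleftrightarrow> ?P")
  proof
    assume "pair_graph G"
    then interpret pair_graph G .
    show ?P
      using pair_finite_verts pair_sym_arcs arc_fst_in_verts arc_snd_in_verts pair_no_loops
      by (fastforce simp: symmetric_def)
  next
    assume P: ?P
    then have "finite (parcs G)" by (metis finite_SigmaI finite_subset)
    with P show "pair_graph G"
      by unfold_locales (auto simp: symmetric_def)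
  qed
  show ?thesis
  proof
    assume T: "undirected_tree G"
    then have g: "pair_graph G" by (simp add: undirected_tree_def)
    then show ?R
      using T graph conn no_long_cycle_iff_bridges[OF g] by (simp add: undirected_tree_def)
  next
    assume R: ?R
    \<comment> \<open>The bridge condition excludes loops, since the reflexive closure always
      contains \<open>(u, u)\<close>.\<close>
    then have "\<forall>u. (u, u) \<notin> parcs G" by blast
    with R graph have g: "pair_graph G" by simp
    then show "undirected_tree G"
      using R conn no_long_cycle_iff_bridges[OF g] by (simp add: undirected_tree_def)
  qed
qed

lemma leaf_iff: "leaf G v \<longleftrightarrow> v \<in> pverts G \<and> card (parcs G `` {v}) = 1"
proof -
  have "out_arcs (with_proj G) v = Pair v ` (parcs G `` {v})"
    by (auto simp: out_arcs_def)
  then show ?thesis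
    by (simp add: leaf_def out_degree_def card_image inj_on_def)
qed

subsection \<open>The metric of a tree\<close>

lemma relpow_sym: "sym R \<Longrightarrow> (u, v) \<in> R ^^ n \<Longrightarrow> (v, u) \<in> R ^^ n"
proof (induction n arbitrary: v)
  case (Suc n)
  then obtain w where "(u, w) \<in> R ^^ n" "(w, v) \<in> R" by auto
  with Suc show ?case by (metis relpow_Suc_I2 symD)
qed auto

text \<open>Steps that \<open>r\<close> collapses are allowed, so this covers contractions, such as
  the projection of a walk onto one part of a join.\<close>

lemma rtrancl_map:
  assumes "(p, q) \<in> R\<^sup>*" and "\<And>x y. (x, y) \<in> R \<Longrightarrow> (r x, r y) \<in> R' \<or> r x = r y"
  shows "(r p, r q) \<in> R'\<^sup>*"
  using assms(1) by induction (use assms(2) in \<open>fastforce intro: rtrancl_into_rtrancl\<close>)+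

locale utree =
  fixes G :: "'a pair_pre_digraph"
  assumes tree: "undirected_tree G"
begin

abbreviation "V \<equiv> pverts G"
abbreviation "E \<equiv> parcs G"
abbreviation "d \<equiv> gdist G"

lemma finite_V: "finite V" and V_nonempty: "V \<noteq> {}" and E_subset: "E \<subseteq> V \<times> V"
  and sym_E: "sym E"
  and conn: "u \<in> V \<Longrightarrow> v \<in> V \<Longrightarrow> (u, v) \<in> E\<^sup>*"
  and bridge: "(u, v) \<in> E \<Longrightarrow> (u, v) \<notin> (E - {(u, v), (v, u)})\<^sup>*"
  using tree unfolding undirected_tree_iff by blast+

lemma E_in_V: "(u, v) \<in> E \<Longrightarrow> u \<in> V" "(u, v) \<in> E \<Longrightarrow> v \<in> V"
  using E_subset by auto

lemma E_sym: "(u, v) \<in> E \<Longrightarrow> (v, u) \<in> E"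
  using sym_E by (auto dest: symD)

lemma gdist_eq: "u \<in> V \<Longrightarrow> d u v = (LEAST l. (u, v) \<in> E ^^ l)"
  using E_subset by (intro gdist_eq_Least) (unfold_locales, auto)

lemma gdist_walk: "u \<in> V \<Longrightarrow> v \<in> V \<Longrightarrow> (u, v) \<in> E ^^ d u v"
  using conn by (metis LeastI gdist_eq rtrancl_power)

lemma gdist_le: "u \<in> V \<Longrightarrow> (u, v) \<in> E ^^ n \<Longrightarrow> d u v \<le> n"
  by (simp add: gdist_eq Least_le)

lemma gdist_self [simp]: "u \<in> V \<Longrightarrow> d u u = 0"
  using gdist_le[of u u 0] by simp

lemma gdist_eq_0_iff [simp]: "u \<in> V \<Longrightarrow> v \<in> V \<Longrightarrow> d u v = 0 \<longleftrightarrow> u = v"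
  using gdist_walk[of u v] by auto

lemma gdist_sym: "u \<in> V \<Longrightarrow> v \<in> V \<Longrightarrow> d u v = d v u"
  by (meson gdist_le gdist_walk le_antisym relpow_sym sym_E)

lemma gdist_triangle: "u \<in> V \<Longrightarrow> v \<in> V \<Longrightarrow> w \<in> V \<Longrightarrow> d u w \<le> d u v + d v w"
  by (rule gdist_le[OF _ relpow_trans[OF gdist_walk gdist_walk]])

lemma gdist_edge: "(u, v) \<in> E \<Longrightarrow> d u v \<le> 1"
  by (intro gdist_le) (auto dest: E_in_V)

lemma gdist_edge_le: "(u, a) \<in> E \<Longrightarrow> y \<in> V \<Longrightarrow> d u y \<le> Suc (d a y)"
  using gdist_triangle[of u a y] gdist_edge[of u a] E_in_V by fastforce

text \<open>The first vertex of a shortest walk will do: the rest of the walk bounds its distance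
  from above, \<open>gdist_edge_le\<close> from below.\<close>

lemma gdist_step:
  assumes "u \<in> V" "y \<in> V" "u \<noteq> y"
  obtains a where "(u, a) \<in> E" "d u y = Suc (d a y)"
proof -
  obtain n where n: "d u y = Suc n" using assms by (metis gdist_eq_0_iff not0_implies_Suc)
  then obtain a where a: "(u, a) \<in> E" "(a, y) \<in> E ^^ n"
    using gdist_walk[of u y] assms by (metis relpow_Suc_D2)
  then have "d a y \<le> n" using E_in_V by (intro gdist_le)
  with gdist_edge_le[OF a(1) assms(2)] n a(1) that show ?thesis by simp
qed

text \<open>A shortest walk that also records the distances along it; these show which edges the
  walk cannot use.\<close>

lemma descending_walk:
  assumes "p \<in> V" "y \<in> V"
  shows "(p, y) \<in> (E \<inter> {(q, r). d r y < d q y \<and> d q y \<le> d p y})\<^sup>*"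
  using assms(1)
proof (induction "d p y" arbitrary: p rule: less_induct)
  case less
  show ?case
  proof (cases "p = y")
    case False
    then obtain a where a: "(p, a) \<in> E" "d p y = Suc (d a y)"
      using gdist_step less.prems assms(2) by metis
    then have "(a, y) \<in> (E \<inter> {(q, r). d r y < d q y \<and> d q y \<le> d a y})\<^sup>*"
      by (intro less.hyps) (auto dest: E_in_V)
    moreover have "(E \<inter> {(q, r). d r y < d q y \<and> d q y \<le> d a y})\<^sup>*
        \<subseteq> (E \<inter> {(q, r). d r y < d q y \<and> d q y \<le> d p y})\<^sup>*"
      using a by (intro rtrancl_mono) auto
    ultimately show ?thesis
      using a by (intro converse_rtrancl_into_rtrancl[of p a]) auto
  qed simp
qed

text \<open>Applied with the two arcs of one edge as \<open>X\<close>, this yields the pieces of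
  detours that the bridge property forbids.\<close>

lemma descending_walk_avoids:
  assumes "p \<in> V" "y \<in> V"
    and "\<And>q r. (q, r) \<in> X \<Longrightarrow> d r y < d q y \<Longrightarrow> d q y \<le> d p y \<Longrightarrow> False"
  shows "(p, y) \<in> (E - X)\<^sup>*"
  by (rule subsetD[OF rtrancl_mono descending_walk]) (use assms in auto)

lemma rtrancl_del_edge_sym:
  "(p, q) \<in> (E - {(u, v), (v, u)})\<^sup>* \<Longrightarrow> (q, p) \<in> (E - {(u, v), (v, u)})\<^sup>*"
  using sym_rtrancl[OF sym_del_edge[OF sym_E]] by (auto dest: symD)

text \<open>Trees are bipartite: for equal distances, shortest walks from both ends to
  \<open>y\<close> avoid the edge and together form a detour around it.\<close>

lemma gdist_adjacent_neq:
  assumes "(u, a) \<in> E" "y \<in> V"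
  shows "d u y \<noteq> d a y"
proof
  assume eq: "d u y = d a y"
  have "(u, y) \<in> (E - {(u, a), (a, u)})\<^sup>*" "(a, y) \<in> (E - {(u, a), (a, u)})\<^sup>*"
    using assms eq by (auto intro!: descending_walk_avoids dest: E_in_V)
  then have "(u, a) \<in> (E - {(u, a), (a, u)})\<^sup>*"
    using rtrancl_del_edge_sym rtrancl_trans by metis
  with bridge assms(1) show False by blast
qed

lemma gdist_adjacent_cases:
  assumes "(u, a) \<in> E" "y \<in> V"
  obtains "d u y = Suc (d a y)" | "d a y = Suc (d u y)"
  using gdist_adjacent_neq[OF assms] gdist_edge_le[OF assms] gdist_edge_le[OF E_sym[OF assms(1)] assms(2)]
  by linarith

text \<open>If \<open>b\<close> were closer too, a walk from \<open>u\<close> through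
  \<open>b\<close> and \<open>y\<close> to \<open>a\<close> would avoid the edge between
  \<open>u\<close> and \<open>a\<close>, against the bridge property.\<close>

lemma unique_closer_neighbour:
  assumes "(u, a) \<in> E" "(u, b) \<in> E" "a \<noteq> b" "y \<in> V" "d a y < d u y"
  shows "d b y = Suc (d u y)"
proof (rule ccontr)
  let ?F = "E - {(u, a), (a, u)}"
  assume "\<not> ?thesis"
  then have b: "d b y < d u y"
    using gdist_adjacent_cases[OF assms(2,4)] by (metis lessI)
  have "(a, y) \<in> ?F\<^sup>*" "(b, y) \<in> ?F\<^sup>*"
    using assms b by (auto intro!: descending_walk_avoids dest: E_in_V)
  moreover have "(u, b) \<in> ?F" using assms by auto
  ultimately have "(u, a) \<in> ?F\<^sup>*"
    by (meson converse_rtrancl_into_rtrancl rtrancl_del_edge_sym rtrancl_trans)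
  with bridge assms(1) show False by blast
qed

text \<open>Once a step towards \<open>v\<close> leads away from \<open>y\<close>, so does the next,
  because the vertex just left is the only neighbour closer to \<open>y\<close>.\<close>

lemma gdist_additive:
  assumes "(m, a) \<in> E" "y \<in> V" "v \<in> V" "d a y = Suc (d m y)" "d m v = Suc (d a v)"
  shows "d y v = d y m + d m v"
  using assms
proof (induction "d a v" arbitrary: m a)
  case 0
  then have "a = v" using E_in_V by (metis gdist_eq_0_iff)
  with 0 show ?case using E_in_V gdist_sym by (metis add.commute add_Suc_right plus_nat.add_0)
next
  case (Suc n)
  then have V: "m \<in> V" "a \<in> V" using E_in_V by auto
  have "a \<noteq> v" using Suc.hyps(2) V by auto
  then obtain a' where a': "(a, a') \<in> E" "d a v = Suc (d a' v)"
    using gdist_step V Suc.prems by metis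
  then have "a' \<noteq> m" using Suc.prems by auto
  then have "d a' y = Suc (d a y)"
    using unique_closer_neighbour[of a m a' y] a' Suc.prems E_sym by auto
  then have "d y v = d y a + d a v"
    using Suc.hyps a' Suc.prems by (intro Suc.hyps(1)[of a' a]) auto
  then show ?case using Suc.prems V gdist_sym[of y a] gdist_sym[of y m] by simp
qed

text \<open>At an interior \<open>m\<close> the neighbours towards \<open>v\<close> and
  \<open>w\<close> differ, so at most one of them is closer to \<open>y\<close>; on the side of the
  other, distances from \<open>y\<close> add up.\<close>

lemma gdist_via_geodesic:
  assumes "v \<in> V" "w \<in> V" "m \<in> V" "y \<in> V" "d v m + d m w = d v w"
  shows "d y v = d y m + d m v \<or> d y w = d y m + d m w"
proof (cases "m = v \<or> m = w")
  case False
  then obtain a b where a: "(m, a) \<in> E" "d m v = Suc (d a v)"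
    and b: "(m, b) \<in> E" "d m w = Suc (d b w)"
    using gdist_step assms by metis
  have V: "a \<in> V" "b \<in> V" using a b E_in_V by auto
  have "a \<noteq> b"
  proof
    assume "a = b"
    then have "d v w \<le> d a v + d b w"
      using gdist_triangle[of v a w] gdist_sym[of v a] assms V by simp
    then show False using assms a b gdist_sym[of v m] by simp
  qed
  show ?thesis
    using gdist_adjacent_cases[OF a(1) assms(4)]
  proof cases
    case 1
    then have "d b y = Suc (d m y)"
      using unique_closer_neighbour a b \<open>a \<noteq> b\<close> assms by (metis lessI)
    then show ?thesis using gdist_additive b assms by blast
  next
    case 2
    then show ?thesis using gdist_additive a assms by blast
  qed
qed (use assms in auto)

lemma gdist_edge_eq: "(u, v) \<in> E \<Longrightarrow> d u v = 1"
  using gdist_edge[of u v] gdist_adjacent_neq[of u v v] E_in_V by fastforce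

end

subsection \<open>Joining two trees by an edge\<close>

context
  fixes S B :: "'a pair_pre_digraph" and i k :: 'a
  assumes trees: "undirected_tree S" "undirected_tree B"
    and disj: "pverts S \<inter> pverts B = {}" and ik: "i \<in> pverts S" "k \<in> pverts B"
begin

text \<open>Every vertex reaches \<open>i\<close>, which gives connectedness; an alleged detour
  around an edge is refuted by its image under a contraction.\<close>

lemma undirected_tree_join: "undirected_tree (join_by_edge S i B k)"
proof -
  interpret S: utree S by unfold_locales fact
  interpret B: utree B by unfold_locales fact
  let ?E = "S.E \<union> B.E \<union> {(i, k), (k, i)}"
  have sym: "sym ?E" using S.sym_E B.sym_E by (auto simp: sym_def)
  have toi: "(y, i) \<in> ?E\<^sup>*" if "y \<in> S.V \<union> B.V" for y
  proof (cases "y \<in> S.V")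
    case True
    have "S.E\<^sup>* \<subseteq> ?E\<^sup>*" by (intro rtrancl_mono) auto
    with True show ?thesis using S.conn ik by blast
  next
    case False
    have "B.E\<^sup>* \<subseteq> ?E\<^sup>*" by (intro rtrancl_mono) auto
    then have "(y, k) \<in> ?E\<^sup>*" using that False B.conn ik by blast
    then show ?thesis by (rule rtrancl_into_rtrancl) simp
  qed
  have conn: "(u, v) \<in> ?E\<^sup>*" if "u \<in> S.V \<union> B.V" "v \<in> S.V \<union> B.V" for u v
    using toi[OF that(1)] toi[OF that(2)] sym_rtrancl[OF sym] by (meson rtrancl_trans symD)
  have br: "(p, q) \<notin> (?E - {(p, q), (q, p)})\<^sup>*" if pq: "(p, q) \<in> ?E" for p q
  proof
    assume walk: "(p, q) \<in> (?E - {(p, q), (q, p)})\<^sup>*"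
    consider "(p, q) \<in> S.E" | "(p, q) \<in> B.E" | "(p, q) = (i, k)" | "(p, q) = (k, i)"
      using pq by auto
    then show False
    proof cases \<comment> \<open>contract the part of the join that does not contain the edge to a point\<close>
      case 1
      let ?r = "\<lambda>y. if y \<in> S.V then y else i"
      have "(?r p, ?r q) \<in> (S.E - {(p, q), (q, p)})\<^sup>*"
        by (rule rtrancl_map[OF walk]) (use S.E_subset B.E_subset disj ik in auto)
      then show False using S.bridge 1 S.E_in_V by auto
    next
      case 2
      let ?r = "\<lambda>y. if y \<in> B.V then y else k"
      have "(?r p, ?r q) \<in> (B.E - {(p, q), (q, p)})\<^sup>*"
        by (rule rtrancl_map[OF walk]) (use S.E_subset B.E_subset disj ik in auto)
      then show False using B.bridge 2 B.E_in_V by auto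
    next
      case 3
      \<comment> \<open>Both trees shrink to points and the new edge is the one deleted, so the
        image relation is empty and the walk would have to stay put.\<close>
      let ?r = "\<lambda>y. if y \<in> S.V then i else k"
      have "(?r p, ?r q) \<in> ({} - {(p, q), (q, p)})\<^sup>*"
        by (rule rtrancl_map[OF walk]) (use 3 S.E_subset B.E_subset disj ik in auto)
      then show False using 3 disj ik by (auto split: if_splits)
    next
      case 4
      let ?r = "\<lambda>y. if y \<in> S.V then i else k"
      have "(?r p, ?r q) \<in> ({} - {(p, q), (q, p)})\<^sup>*"
        by (rule rtrancl_map[OF walk]) (use 4 S.E_subset B.E_subset disj ik in auto)
      then show False using 4 disj ik by (auto split: if_splits)
    qed
  qed
  show ?thesis
    unfolding undirected_tree_iff join_by_edge_def
    using S.finite_V B.finite_V S.V_nonempty S.E_subset B.E_subset ik sym conn br by auto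
qed

text \<open>Only distances from vertices of \<open>S\<close> are treated; those inside
  \<open>B\<close> follow by exchanging the trees with \<open>join_by_edge_commute\<close>.\<close>

lemma gdist_join:
  assumes "s \<in> pverts S"
  shows "s' \<in> pverts S \<Longrightarrow> gdist (join_by_edge S i B k) s s' = gdist S s s'"
    and "b \<in> pverts B \<Longrightarrow>
      gdist (join_by_edge S i B k) s b = gdist S s i + 1 + gdist B k b"
proof -
  interpret S: utree S by unfold_locales fact
  interpret B: utree B by unfold_locales fact
  interpret J: utree "join_by_edge S i B k" by unfold_locales (rule undirected_tree_join)
  have VJ: "J.V = S.V \<union> B.V" and EJ: "J.E = S.E \<union> B.E \<union> {(i, k), (k, i)}"
    by (auto simp: join_by_edge_def)
  txt \<open>The claimed distance from \<open>s\<close> grows by at most one along every edge, hence is a lower bound.\<close>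
  define f where "f y = (if y \<in> S.V then S.d s y else S.d s i + 1 + B.d k y)" for y
  have lip: "f y \<le> Suc (f x)" if xy: "(x, y) \<in> J.E" for x y
  proof -
    consider "(x, y) \<in> S.E" | "(x, y) \<in> B.E" | "(x, y) = (i, k)" | "(x, y) = (k, i)"
      using xy EJ by auto
    then show ?thesis
    proof cases
      case 1
      then have xy: "x \<in> S.V" "y \<in> S.V" using S.E_in_V by auto
      have "S.d y s \<le> Suc (S.d x s)" by (rule S.gdist_edge_le[OF S.E_sym[OF 1] assms])
      then show ?thesis using xy assms by (simp add: f_def S.gdist_sym[of s])
    next
      case 2
      then have xy: "x \<in> B.V" "y \<in> B.V" using B.E_in_V by auto
      then have "x \<notin> S.V" "y \<notin> S.V" using disj by auto
      have "B.d y k \<le> Suc (B.d x k)" by (rule B.gdist_edge_le[OF B.E_sym[OF 2] ik(2)])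
      then show ?thesis
        using xy ik \<open>x \<notin> S.V\<close> \<open>y \<notin> S.V\<close> by (simp add: f_def B.gdist_sym[of k])
    qed (use ik disj in \<open>auto simp: f_def\<close>)
  qed
  have bound: "f y \<le> n" if "(s, y) \<in> J.E ^^ n" for y n
    using that
  proof (induction n arbitrary: y)
    case 0
    then show ?case using assms by (simp add: f_def)
  next
    case (Suc n)
    then obtain x where "(s, x) \<in> J.E ^^ n" "(x, y) \<in> J.E" by auto
    with Suc.IH lip show ?case by (meson Suc_le_mono le_trans)
  qed
  have lower: "f y \<le> J.d s y" if "y \<in> J.V" for y
    using bound J.gdist_walk that assms VJ by blast
  have mono: "p \<in> R ^^ n \<Longrightarrow> R \<subseteq> R' \<Longrightarrow> p \<in> R' ^^ n" for p n and R R' :: "'a rel"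
    by (cases p) (auto simp: relpow_iff_pcas)
  have upS: "J.d s x \<le> S.d s x" if "x \<in> S.V" for x
    by (intro J.gdist_le mono[OF S.gdist_walk]) (use assms that VJ EJ in auto)
  show "J.d s s' = S.d s s'" if "s' \<in> S.V"
    using upS[OF that] lower[of s'] that VJ by (simp add: f_def)
  show "J.d s b = S.d s i + 1 + B.d k b" if "b \<in> B.V"
  proof -
    have "J.d k b \<le> B.d k b"
      by (intro J.gdist_le mono[OF B.gdist_walk]) (use ik that VJ EJ in auto)
    moreover have "J.d i k \<le> 1" by (rule J.gdist_edge) (simp add: EJ)
    moreover have "J.d s b \<le> J.d s i + (J.d i k + J.d k b)"
      using J.gdist_triangle[of s i b] J.gdist_triangle[of i k b] VJ assms ik that by simp
    moreover have "b \<notin> S.V" using that disj by auto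
    ultimately show ?thesis
      using upS[OF ik(1)] lower[of b] that VJ by (simp add: f_def)
  qed
qed

end

lemma join_by_edge_commute: "join_by_edge S i B k = join_by_edge B k S i"
  by (auto simp: join_by_edge_def)

subsection \<open>Wiener index and centers\<close>

context utree begin

text \<open>Each two-element set has two orderings of equal distance, and the diagonal adds 0.
  Ordered pairs make the sum easy to split and reindex.\<close>

lemma twice_wiener_index: "2 * wiener_index G = (\<Sum>v\<in>V. \<Sum>w\<in>V. d v w)"
proof -
  let ?P = "{e. e \<subseteq> V \<and> card e = 2}"
  let ?D = "{(v, w). v \<in> V \<and> w \<in> V \<and> v \<noteq> w}"
  let ?g = "\<lambda>e. THE l. \<exists>v w. e = {v, w} \<and> l = d v w"
  have finP: "finite ?P" using finite_V by simp
  have finD: "finite ?D" by (rule finite_subset[of _ "V \<times> V"]) (use finite_V in auto)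
  have fibre: "(\<Sum>x | x \<in> ?D \<and> (case x of (v, w) \<Rightarrow> {v, w}) = e. case x of (v, w) \<Rightarrow> d v w) = 2 * ?g e" if e: "e \<in> ?P" for e
  proof -
    obtain a b where e: "e = {a, b}" "a \<noteq> b" "a \<in> V" "b \<in> V"
      using e by (auto simp: card_2_iff)
    have "?g e = d a b"
      by (rule the_equality) (use e gdist_sym in \<open>auto simp: doubleton_eq_iff\<close>)
    moreover have "{x. x \<in> ?D \<and> (case x of (v, w) \<Rightarrow> {v, w}) = e} = {(a, b), (b, a)}"
      using e by (auto simp: doubleton_eq_iff)
    ultimately show ?thesis using e gdist_sym[of a b] by simp
  qed
  have "(\<Sum>v\<in>V. \<Sum>w\<in>V. d v w) = (\<Sum>(v, w)\<in>V \<times> V. d v w)"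
    by (simp add: sum.cartesian_product)
  also have "\<dots> = (\<Sum>(v, w)\<in>?D. d v w)"
    by (rule sum.mono_neutral_right) (use finite_V in auto)
  also have "\<dots> = (\<Sum>e\<in>?P. \<Sum>x | x \<in> ?D \<and> (case x of (v, w) \<Rightarrow> {v, w}) = e. case x of (v, w) \<Rightarrow> d v w)"
    by (rule sum.group[symmetric, OF finD finP]) (auto simp: card_2_iff)
  also have "\<dots> = (\<Sum>e\<in>?P. 2 * ?g e)"
    by (rule sum.cong[OF refl fibre])
  finally show ?thesis by (simp add: wiener_index_def sum_distrib_left)
qed

section \<open>Eccentricity, diameter and centers\<close>

lemma eccentricity_ge: "v \<in> V \<Longrightarrow> w \<in> V \<Longrightarrow> d w v \<le> eccentricity G v"
  unfolding eccentricity_def using finite_V by (intro Max_ge) auto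

lemma eccentricity_le_iff: "eccentricity G v \<le> n \<longleftrightarrow> (\<forall>w\<in>V. d w v \<le> n)"
  unfolding eccentricity_def using finite_V V_nonempty by (subst Max_le_iff) auto

lemma diameter_le_iff: "diameter G \<le> n \<longleftrightarrow> (\<forall>v\<in>V. \<forall>w\<in>V. d v w \<le> n)"
  unfolding diameter_def using finite_V V_nonempty
  by (subst Max_le_iff) (auto simp: eccentricity_le_iff)

lemma gdist_le_diameter: "v \<in> V \<Longrightarrow> w \<in> V \<Longrightarrow> d v w \<le> diameter G"
  using diameter_le_iff by blast

lemma diameter_attained: obtains v w where "v \<in> V" "w \<in> V" "d v w = diameter G"
proof -
  have "diameter G \<in> eccentricity G ` V"
    unfolding diameter_def using finite_V V_nonempty by (intro Max_in) auto
  then obtain w where w: "w \<in> V" "diameter G = eccentricity G w" by auto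
  have "eccentricity G w \<in> (\<lambda>v. d v w) ` V"
    unfolding eccentricity_def using finite_V V_nonempty by (intro Max_in) auto
  with w that show ?thesis by auto
qed

lemma diameter_eqI:
  assumes "\<And>v w. v \<in> V \<Longrightarrow> w \<in> V \<Longrightarrow> d v w \<le> n" and "v \<in> V" "w \<in> V" "d v w = n"
  shows "diameter G = n"
  using assms by (metis diameter_le_iff gdist_le_diameter le_antisym)

text \<open>
  A midpoint of a diametral path is a center: by \<open>gdist_via_geodesic\<close>, every vertex is at most
  as far from it as the farther end of the path.
\<close>

lemma gsetdist_centers_diametral:
  assumes "v \<in> V" "w \<in> V" and diam: "d v w = diameter G"
  shows "gsetdist G (centers G) v = diameter G div 2"
proof -
  let ?D = "diameter G"
  \<comment> \<open>Walking along a geodesic from \<open>v\<close> to \<open>w\<close> meets every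
    intermediate distance.\<close>
  have "\<exists>m\<in>V. d v m = n \<and> n + d m w = d v w" if "n \<le> d v w" for n
    using that
  proof (induction n)
    case 0
    then show ?case using assms by auto
  next
    case (Suc n)
    then obtain m where m: "m \<in> V" "d v m = n" "n + d m w = d v w" by auto
    with Suc.prems have "m \<noteq> w" using assms by auto
    then obtain a where a: "(m, a) \<in> E" "d m w = Suc (d a w)"
      using gdist_step m assms by metis
    then have aV: "a \<in> V" using E_in_V by simp
    have "d v a \<le> d v m + 1"
      using gdist_triangle[of v m a] gdist_edge[OF a(1)] aV m assms by simp
    moreover have "d v w \<le> d v a + d a w"
      using gdist_triangle[of v a w] aV assms by simp
    ultimately show ?case using aV a m by (intro bexI[of _ a]) auto
  qed
  \<comment> \<open>Rounding down on the side of \<open>v\<close> picks, for odd diameter, the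
    center nearer to \<open>v\<close>.\<close>
  then obtain m where m: "m \<in> V" "d v m = ?D div 2" "d v m + d m w = ?D"
    using diam by (metis div_le_dividend)
  \<comment> \<open>Any vertex has distance at least the rounded-up half
    \<open>?D - ?D div 2\<close> from one of \<open>v\<close> and \<open>w\<close>.\<close>
  have radius_le: "?D - ?D div 2 \<le> eccentricity G c" if "c \<in> V" for c
  proof -
    have "?D \<le> d v c + d w c"
      using gdist_triangle[of v c w] gdist_sym[of c w] that assms by simp
    then show ?thesis
      using eccentricity_ge[OF that assms(1)] eccentricity_ge[OF that assms(2)] by linarith
  qed
  \<comment> \<open>Going from \<open>y\<close> through \<open>m\<close> to one of the ends realises
    a distance, so it has length at most \<open>?D\<close>, and each half of the path has length at
    least \<open>?D div 2\<close>.\<close>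
  have "d y m \<le> ?D - ?D div 2" if y: "y \<in> V" for y
  proof -
    have "d y v \<le> ?D" "d y w \<le> ?D" using gdist_le_diameter y assms by auto
    then show ?thesis
      using gdist_via_geodesic[of v w m y] m y assms gdist_sym[of v m] by auto
  qed
  then have ecc_m: "eccentricity G m = ?D - ?D div 2"
    using radius_le[OF m(1)] by (simp add: eccentricity_le_iff le_antisym)
  then have "?D - ?D div 2 \<in> eccentricity G ` V" using m(1) by (metis imageI)
  then have radius: "Min (eccentricity G ` V) = ?D - ?D div 2"
    using finite_V radius_le by (intro Min_eqI) auto
  have "d m v = ?D div 2" using m gdist_sym assms by simp
  \<comment> \<open>A center is at most the rounded-up half from \<open>w\<close>, which leaves at
    least the rounded-down half to \<open>v\<close>.\<close>
  moreover have "?D div 2 \<le> d c v" if "c \<in> centers G" for c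
  proof -
    have c: "c \<in> V" "eccentricity G c = ?D - ?D div 2"
      using that radius by (auto simp: centers_def)
    then have "d c w \<le> ?D - ?D div 2"
      using eccentricity_ge[of c w] gdist_sym[of c w] assms by simp
    moreover have "?D \<le> d c v + d c w"
      using gdist_triangle[of v c w] gdist_sym[of c v] c assms by simp
    ultimately show ?thesis by linarith
  qed
  moreover have "m \<in> centers G" using m ecc_m radius by (simp add: centers_def)
  moreover have "finite (centers G)" using finite_V by (simp add: centers_def)
  ultimately show ?thesis
    unfolding gsetdist_def by (intro Min_eqI) force+
qed

text \<open>An interior vertex of a geodesic has a neighbour towards each end. At a leaf these
  coincide, which gives a shortcut between \<open>v\<close> and \<open>w\<close>.\<close>

lemma leaf_on_geodesic:
  assumes "leaf G h" "v \<in> V" "w \<in> V" "d v h + d h w = d v w"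
  shows "h = v \<or> h = w"
proof (rule ccontr)
  assume *: "\<not> ?thesis"
  have h: "h \<in> V" "card (E `` {h}) = 1" using assms by (auto simp: leaf_iff)
  obtain a b where a: "(h, a) \<in> E" "d h v = Suc (d a v)"
    and b: "(h, b) \<in> E" "d h w = Suc (d b w)"
    using gdist_step h * assms by metis
  have "a \<in> E `` {h}" "b \<in> E `` {h}" using a b by auto
  then have "a = b" using h(2) by (metis card_1_singletonE singletonD)
  moreover have "a \<in> V" using a E_in_V by simp
  ultimately have "d v w \<le> d a v + d b w"
    using gdist_triangle[of v a w] gdist_sym[of v a] assms by simp
  then show False using assms a b h gdist_sym[of v h] by simp
qed

text \<open>The parts are the components of \<open>u\<close> and \<open>x\<close> after deleting the
  edge; they are disjoint because the edge is a bridge.\<close>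

lemma split_at_edge:
  assumes "(u, x) \<in> E"
  obtains S B where "undirected_tree S" "undirected_tree B" "pverts S \<inter> pverts B = {}"
    "u \<in> pverts S" "x \<in> pverts B" "G = join_by_edge S u B x"
proof -
  let ?F = "E - {(u, x), (x, u)}"
  define part where "part r = \<lparr> pverts = {y. (r, y) \<in> ?F\<^sup>*}, parcs = ?F \<inter> {y. (r, y) \<in> ?F\<^sup>*} \<times> UNIV \<rparr>"
    for r
  have cl: "z \<in> V" if "(r, z) \<in> ?F\<^sup>*" "r \<in> V" for r z
    using that by induction (use E_in_V in auto)
  have tree_part: "undirected_tree (part r)" if r: "r \<in> V" for r
    unfolding undirected_tree_iff
  proof (intro conjI ballI allI impI)
    show "finite (pverts (part r))"
      by (rule finite_subset[OF _ finite_V]) (use cl r in \<open>auto simp: part_def\<close>)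
    show "pverts (part r) \<noteq> {}" by (auto simp: part_def)
    show sub: "parcs (part r) \<subseteq> pverts (part r) \<times> pverts (part r)"
      by (auto simp: part_def intro: rtrancl_into_rtrancl)
    show "sym (parcs (part r))"
      using sub by (auto simp: part_def sym_def E_sym)
    have out: "(r, y) \<in> (parcs (part r))\<^sup>*" and inward: "(y, r) \<in> (parcs (part r))\<^sup>*"
      if "(r, y) \<in> ?F\<^sup>*" for y
    proof -
      show "(r, y) \<in> (parcs (part r))\<^sup>*"
        using that
        by induction (auto simp: part_def intro: rtrancl_into_rtrancl)
      then show "(y, r) \<in> (parcs (part r))\<^sup>*"
        using sym_rtrancl[OF \<open>sym (parcs (part r))\<close>] by (auto dest: symD)
    qed
    show "(y, z) \<in> (parcs (part r))\<^sup>*" if "y \<in> pverts (part r)" "z \<in> pverts (part r)" for y z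
      using that out inward by (auto simp: part_def intro: rtrancl_trans)
    show "(p, q) \<notin> (parcs (part r) - {(p, q), (q, p)})\<^sup>*" if "(p, q) \<in> parcs (part r)" for p q
    proof -
      have "(parcs (part r) - {(p, q), (q, p)})\<^sup>* \<subseteq> (E - {(p, q), (q, p)})\<^sup>*"
        by (rule rtrancl_mono) (auto simp: part_def)
      then show ?thesis using that bridge[of p q] by (auto simp: part_def)
    qed
  qed
  have disj: "pverts (part u) \<inter> pverts (part x) = {}"
  proof -
    have False if "(u, y) \<in> ?F\<^sup>*" "(x, y) \<in> ?F\<^sup>*" for y
      using rtrancl_trans[OF that(1) rtrancl_del_edge_sym[OF that(2)]] bridge[OF assms] by blast
    then show ?thesis by (auto simp: part_def)
  qed
  have verts: "V = pverts (part u) \<union> pverts (part x)"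
  proof
    show "V \<subseteq> pverts (part u) \<union> pverts (part x)"
    proof
      fix y assume "y \<in> V"
      then have "(u, y) \<in> E\<^sup>*" using assms conn E_in_V by metis
      \<comment> \<open>A step along the deleted edge ends in \<open>u\<close> or \<open>x\<close>,
        where reachability starts afresh.\<close>
      then have "(u, y) \<in> ?F\<^sup>* \<or> (x, y) \<in> ?F\<^sup>*"
        by induction (auto intro: rtrancl_into_rtrancl)
      then show "y \<in> pverts (part u) \<union> pverts (part x)" by (auto simp: part_def)
    qed
  qed (use assms cl E_in_V in \<open>auto simp: part_def\<close>)
  have parcs_part: "parcs (part r) = ?F \<inter> pverts (part r) \<times> UNIV" for r
    by (simp add: part_def)
  have "E = parcs (part u) \<union> parcs (part x) \<union> {(u, x), (x, u)}"
    unfolding parcs_part using verts assms E_sym[OF assms] E_subset by blast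
  with verts have "G = join_by_edge (part u) u (part x) x"
    by (simp add: join_by_edge_def)
  moreover have "u \<in> pverts (part u)" "x \<in> pverts (part x)" by (simp_all add: part_def)
  ultimately show ?thesis
    using that tree_part[of u] tree_part[of x] disj E_in_V[OF assms] by blast
qed

end

text \<open>Cross distances split as \<open>gdist S i s + 1 + gdist B k b\<close>. Of the resulting
  terms only the distance sum of \<open>i\<close> in \<open>S\<close> changes when the edge from
  \<open>k\<close> is moved to another vertex of \<open>S\<close>.\<close>

lemma wiener_index_join:
  assumes "undirected_tree S" "undirected_tree B" "pverts S \<inter> pverts B = {}"
    "i \<in> pverts S" "k \<in> pverts B"
  shows "wiener_index (join_by_edge S i B k) =
    wiener_index S + wiener_index B + card (pverts S) * card (pverts B) +
    card (pverts B) * (\<Sum>s\<in>pverts S. gdist S i s) + card (pverts S) * (\<Sum>b\<in>pverts B. gdist B k b)"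
proof -
  interpret S: utree S by unfold_locales fact
  interpret B: utree B by unfold_locales fact
  let ?J = "join_by_edge S i B k"
  interpret J: utree ?J by unfold_locales (rule undirected_tree_join[OF assms])
  have VJ: "J.V = S.V \<union> B.V" by (simp add: join_by_edge_def)
  have SS: "J.d s t = S.d s t" if "s \<in> S.V" "t \<in> S.V" for s t
    using that by (rule gdist_join(1)[OF assms])
  have SB: "J.d s b = S.d i s + 1 + B.d k b" if "s \<in> S.V" "b \<in> B.V" for s b
    using gdist_join(2)[OF assms that] S.gdist_sym[OF that(1) assms(4)] by simp
  have BB: "J.d b c = B.d b c" if "b \<in> B.V" "c \<in> B.V" for b c
    using gdist_join(1)[of B S k i b c] assms that by (auto simp: join_by_edge_commute[of S])
  have "2 * wiener_index ?J = (\<Sum>v\<in>S.V \<union> B.V. \<Sum>w\<in>S.V \<union> B.V. J.d v w)"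
    by (simp add: J.twice_wiener_index VJ)
  also have "\<dots> = (\<Sum>s\<in>S.V. \<Sum>t\<in>S.V. J.d s t) + (\<Sum>s\<in>S.V. \<Sum>b\<in>B.V. J.d s b)
      + ((\<Sum>b\<in>B.V. \<Sum>s\<in>S.V. J.d b s) + (\<Sum>b\<in>B.V. \<Sum>c\<in>B.V. J.d b c))"
    using S.finite_V B.finite_V assms(3) by (simp add: sum.union_disjoint sum.distrib)
  also have "(\<Sum>b\<in>B.V. \<Sum>s\<in>S.V. J.d b s) = (\<Sum>s\<in>S.V. \<Sum>b\<in>B.V. J.d s b)"
    by (subst sum.swap) (intro sum.cong refl J.gdist_sym, auto simp: VJ)
  also have "(\<Sum>s\<in>S.V. \<Sum>b\<in>B.V. J.d s b) = (\<Sum>s\<in>S.V. \<Sum>b\<in>B.V. S.d i s + 1 + B.d k b)"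
    by (intro sum.cong refl SB)
  also have "\<dots> = card B.V * (\<Sum>s\<in>S.V. S.d i s) + card S.V * card B.V + card S.V * (\<Sum>b\<in>B.V. B.d k b)"
    by (simp only: sum.distrib) (simp add: sum_distrib_left)
  also have "(\<Sum>s\<in>S.V. \<Sum>t\<in>S.V. J.d s t) = 2 * wiener_index S"
    by (simp add: SS S.twice_wiener_index)
  also have "(\<Sum>b\<in>B.V. \<Sum>c\<in>B.V. J.d b c) = 2 * wiener_index B"
    by (simp add: BB B.twice_wiener_index)
  finally show ?thesis by linarith
qed

subsection \<open>Coverings\<close>

text \<open>Equality in the triangle inequality expresses that \<open>h\<close> lies on the path
  from \<open>v\<close> to \<open>w\<close>, without mentioning a path.\<close>

definition diametral :: "'a pair_pre_digraph \<Rightarrow> 'a \<Rightarrow> bool" where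
  "diametral G h \<longleftrightarrow> (\<exists>v\<in>pverts G. \<exists>w\<in>pverts G.
     gdist G v w = diameter G \<and> gdist G v h + gdist G h w = diameter G)"

context utree
begin

text \<open>A walk from an end of a diametral path to \<open>y\<close> must leave the set of
  diametral vertices along some edge.\<close>

lemma nondiametral_boundary:
  assumes "y \<in> V" "\<not> diametral G y"
  obtains u x where "(u, x) \<in> E" "diametral G u" "\<not> diametral G x"
proof -
  obtain v w where vw: "v \<in> V" "w \<in> V" "d v w = diameter G" by (rule diameter_attained)
  then have v: "diametral G v"
    unfolding diametral_def by (intro bexI[of _ v] bexI[of _ w]) auto
  have "(v, y) \<in> E\<^sup>*" using conn vw assms by blast
  then have "\<exists>u x. (u, x) \<in> E \<and> diametral G u \<and> \<not> diametral G x"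
    using assms(2) by induction (use v in blast)+
  with that show ?thesis by blast
qed

text \<open>The new attachment point \<open>c\<close> is a neighbour of \<open>u\<close> on a
  diametral path through \<open>u\<close>, so \<open>B\<close> moves by a single edge.\<close>

lemma covering_move:
  assumes "(u, x) \<in> E" "diametral G u" "\<not> diametral G x"
  obtains S B c where "undirected_tree S" "undirected_tree B" "pverts S \<inter> pverts B = {}"
    "u \<in> pverts S" "x \<in> pverts B" "G = join_by_edge S u B x" "c \<in> pverts S" "c \<noteq> u"
    "wiener_index G < wiener_index (join_by_edge S c B x)"
    "diameter (join_by_edge S c B x) = diameter G"
proof -
  let ?D = "diameter G"
  obtain S B where SB: "undirected_tree S" "undirected_tree B" "pverts S \<inter> pverts B = {}"
    "u \<in> pverts S" "x \<in> pverts B" and G: "G = join_by_edge S u B x"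
    by (rule split_at_edge[OF assms(1)])
  interpret S: utree S by unfold_locales fact
  interpret B: utree B by unfold_locales fact
  have V: "V = S.V \<union> B.V" and E: "E = S.E \<union> B.E \<union> {(u, x), (x, u)}"
    unfolding G by (auto simp: join_by_edge_def)
  have xV: "x \<in> V" and uV: "u \<in> V" using V SB by auto
  have dS: "d s t = S.d s t" if "s \<in> S.V" "t \<in> S.V" for s t
    using gdist_join(1)[OF SB that] G by simp
  have dSB: "d s b = S.d s u + 1 + B.d x b" if "s \<in> S.V" "b \<in> B.V" for s b
    using gdist_join(2)[OF SB that] G by simp
  have dB: "d b b' = B.d b b'" if "b \<in> B.V" "b' \<in> B.V" for b b'
    using gdist_join(1)[of B S x u b b'] SB that G by (auto simp: join_by_edge_commute[of S])
  obtain v w where vw: "v \<in> V" "w \<in> V" "d v w = ?D" "d v u + d u w = ?D"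
    using assms(2) by (auto simp: diametral_def)
  have far: "d v x + d x w \<noteq> ?D" if "v \<in> V" "w \<in> V" "d v w = ?D" for v w
    using assms(3) that by (auto simp: diametral_def)
  \<comment> \<open>If \<open>x\<close> were closer to \<open>t\<close> than \<open>u\<close> is, it
    would lie on the geodesic from \<open>t\<close> to \<open>t'\<close> and be diametral.\<close>
  have away: "d x t = Suc (d u t)" if t: "t \<in> V" "t' \<in> V" "d t t' = ?D" "d t u + d u t' = ?D" for t t'
    using gdist_adjacent_cases[OF assms(1) t(1)]
  proof cases
    case 1
    have "d x t' \<le> Suc (d u t')" using gdist_edge_le[OF E_sym[OF assms(1)]] t by simp
    moreover have "d t t' \<le> d t x + d x t'" by (rule gdist_triangle[OF t(1) xV t(2)])
    moreover have "d t x = d x t" "d t u = d u t" using gdist_sym t xV uV by auto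
    ultimately have "d t x + d x t' = ?D" using 1 t by simp
    with far t show ?thesis by simp
  qed
  have xv: "d x v = Suc (d u v)" by (rule away[OF vw])
  have xw: "d x w = Suc (d u w)"
    by (rule away[of w v]) (use vw uV gdist_sym in \<open>auto simp: add.commute\<close>)
  \<comment> \<open>Vertices of \<open>B\<close> are closer to \<open>x\<close> than to
    \<open>u\<close>, hence both ends of the diametral path lie in \<open>S\<close>.\<close>
  have inS: "t \<in> S.V" if "d x t = Suc (d u t)" "t \<in> V" for t
  proof (rule ccontr)
    assume "t \<notin> S.V"
    then have "t \<in> B.V" using that V by auto
    then show False using that dSB[of u t] dB[of x t] SB by simp
  qed
  have vwS: "v \<in> S.V" "w \<in> S.V" using inS xv xw vw by auto
  \<comment> \<open>If \<open>u\<close> were an end, \<open>x\<close> would be at distance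
    \<open>?D + 1\<close> from the other end; so \<open>u\<close> has path neighbours on both
    sides.\<close>
  have "u \<noteq> v"
  proof
    assume "u = v"
    then have "d x w = Suc ?D" using xw vw uV by simp
    then show False using gdist_le_diameter[of x w] xV vw by simp
  qed
  have "u \<noteq> w"
  proof
    assume "u = w"
    then have "d x v = Suc ?D" using xv vw uV gdist_sym[of v u] by simp
    then show False using gdist_le_diameter[of x v] xV vw by simp
  qed
  obtain a where a: "(u, a) \<in> E" "d u v = Suc (d a v)"
    using gdist_step uV vw \<open>u \<noteq> v\<close> by metis
  obtain b where b: "(u, b) \<in> E" "d u w = Suc (d b w)"
    using gdist_step uV vw \<open>u \<noteq> w\<close> by metis
  have "a \<noteq> x" "b \<noteq> x" using a b xv xw by auto
  then have uab: "(u, a) \<in> S.E" "(u, b) \<in> S.E"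
    using a b E B.E_in_V SB by auto
  then have abS: "a \<in> S.V" "b \<in> S.V" using S.E_in_V by auto
  have "a \<noteq> b"
  proof
    assume "a = b"
    then have "d v w \<le> d a v + d b w"
      using gdist_triangle[of v a w] gdist_sym[of v a] vw abS V by simp
    then show False using vw a b gdist_sym[of v u] uV by simp
  qed
  let ?s = "\<lambda>c. \<Sum>t\<in>S.V. S.d c t"
  \<comment> \<open>Convexity: for each \<open>t\<close> at most one of \<open>a\<close> and
    \<open>b\<close> is closer than \<open>u\<close>. It is strict at \<open>t = u\<close>, where
    the sides are 0 and 2.\<close>
  have "(\<Sum>t\<in>S.V. 2 * S.d u t) < (\<Sum>t\<in>S.V. S.d a t + S.d b t)"
  proof (rule sum_strict_mono_ex1)
    show "\<forall>t\<in>S.V. 2 * S.d u t \<le> S.d a t + S.d b t"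
    proof
      fix t assume t: "t \<in> S.V"
      show "2 * S.d u t \<le> S.d a t + S.d b t"
        using S.gdist_adjacent_cases[OF uab(1) t]
      proof cases
        case 1
        then have "S.d b t = Suc (S.d u t)"
          using S.unique_closer_neighbour[OF uab \<open>a \<noteq> b\<close> t] by simp
        with 1 show ?thesis by simp
      next
        case 2
        with S.gdist_edge_le[OF uab(2) t] show ?thesis by simp
      qed
    qed
    show "\<exists>t\<in>S.V. 2 * S.d u t < S.d a t + S.d b t"
      using uab abS SB by (intro bexI[of _ u]) (auto simp: S.gdist_edge_eq[OF S.E_sym])
  qed (rule S.finite_V)
  then have "2 * ?s u < ?s a + ?s b"
    by (simp add: sum.distrib sum_distrib_left)
  \<comment> \<open>At least one of the distance sums of \<open>a\<close> and \<open>b\<close>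
    exceeds that of \<open>u\<close>; \<open>c\<close> is such a neighbour.\<close>
  then obtain c where c: "(u, c) \<in> S.E" "?s u < ?s c"
    using uab by (metis add_mono linorder_not_less mult_2)
  then have cS: "c \<in> S.V" using S.E_in_V by auto
  let ?J = "join_by_edge S c B x"
  note SBc = SB(1-3) cS SB(5)
  interpret J: utree ?J by unfold_locales (rule undirected_tree_join[OF SBc])
  have VJ: "J.V = S.V \<union> B.V" by (simp add: join_by_edge_def)
  have JS: "J.d s t = S.d s t" if "s \<in> S.V" "t \<in> S.V" for s t
    by (rule gdist_join(1)[OF SBc that])
  have JSB: "J.d s b = S.d s c + 1 + B.d x b" if "s \<in> S.V" "b \<in> B.V" for s b
    by (rule gdist_join(2)[OF SBc that])
  have JB: "J.d b b' = B.d b b'" if "b \<in> B.V" "b' \<in> B.V" for b b'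
    using gdist_join(1)[of B S x c b b'] SBc that by (auto simp: join_by_edge_commute[of S])
  \<comment> \<open>Geodesics of \<open>G\<close> from \<open>S\<close> to \<open>B\<close> pass
    through \<open>x\<close>, which is not diametral, so cross distances in \<open>G\<close> are
    below \<open>?D\<close>; the move adds at most one.\<close>
  have cross: "J.d s b \<le> ?D" if sb: "s \<in> S.V" "b \<in> B.V" for s b
  proof -
    have sbV: "s \<in> V" "b \<in> V" using sb V by auto
    have "d s b = d s x + d x b"
      using dSB[OF sb] dSB[OF sb(1) SB(5)] dB[OF SB(5) sb(2)] SB by simp
    then have "d s b \<noteq> ?D" using far[OF sbV] by auto
    then have "d s b < ?D" using gdist_le_diameter[OF sbV] by simp
    moreover have "S.d s c \<le> S.d s u + 1"
      using S.gdist_triangle[of s u c] S.gdist_edge[OF c(1)] sb SB cS by simp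
    ultimately show ?thesis using JSB[OF sb] dSB[OF sb] by simp
  qed
  have "diameter ?J = ?D"
  proof (rule J.diameter_eqI)
    fix p q assume "p \<in> J.V" "q \<in> J.V"
    then consider "p \<in> S.V" "q \<in> S.V" | "p \<in> S.V" "q \<in> B.V" | "p \<in> B.V" "q \<in> S.V" | "p \<in> B.V" "q \<in> B.V"
      using VJ by auto
    then show "J.d p q \<le> ?D"
    proof cases
      case 1
      then show ?thesis using JS dS gdist_le_diameter V by (metis UnCI)
    next
      case 2
      then show ?thesis by (rule cross)
    next
      case 3
      then show ?thesis using cross J.gdist_sym VJ by (metis UnCI)
    next
      case 4
      then show ?thesis using JB dB gdist_le_diameter V by (metis UnCI)
    qed
  next
    \<comment> \<open>Both ends lie in \<open>S\<close>, where distances do not change, so the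
      diameter is still attained.\<close>
    show "v \<in> J.V" "w \<in> J.V" using vw V VJ by auto
    show "J.d v w = ?D" using vw vwS JS dS by simp
  qed
  moreover have "wiener_index G < wiener_index ?J"
  proof -
    have "card B.V > 0" using B.finite_V B.V_nonempty by (simp add: card_gt_0_iff)
    then have "card B.V * ?s u < card B.V * ?s c" using c by simp
    then show ?thesis
      using wiener_index_join[OF SB] wiener_index_join[OF SBc] G by simp
  qed
  moreover have "c \<noteq> u" using c by auto
  ultimately show ?thesis using that SB G cS by blast
qed

end

subsection \<open>Isomorphism classes\<close>

text \<open>An arc is the pair of its ends, so the arc map of an isomorphism is induced by its
  vertex map.\<close>

lemma tree_iso_obtain_map:
  assumes "(G, H) \<in> tree_iso"
  obtains f where "inj_on f (pverts G)" "pverts H = f ` pverts G"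
    "parcs H = (\<lambda>(u, v). (f u, f v)) ` parcs G"
proof -
  obtain h where h: "pre_digraph.digraph_isomorphism (with_proj G) h"
    and H: "with_proj H = app_iso h (with_proj G)"
    using assms by (auto simp: tree_iso_def digraph_iso_def)
  have proj: "iso_tail h = fst" "iso_head h = snd" "pverts H = iso_verts h ` pverts G"
    "parcs H = iso_arcs h ` parcs G"
    using arg_cong[OF H, of tail] arg_cong[OF H, of head] arg_cong[OF H, of verts]
      arg_cong[OF H, of arcs] by simp_all
  have "iso_arcs h e = (iso_verts h (fst e), iso_verts h (snd e))" if "e \<in> parcs G" for e
    using h that proj by (auto simp: pre_digraph.digraph_isomorphism_def prod_eq_iff)
  then have "parcs H = (\<lambda>(u, v). (iso_verts h u, iso_verts h v)) ` parcs G"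
    using proj by (auto simp: case_prod_beta image_iff)
  moreover have "inj_on (iso_verts h) (pverts G)"
    using h by (simp add: pre_digraph.digraph_isomorphism_def)
  ultimately show ?thesis using that proj by blast
qed

lemma relpow_map:
  "(u, v) \<in> R ^^ n \<Longrightarrow> (f u, f v) \<in> ((\<lambda>(u, v). (f u, f v)) ` R) ^^ n"
proof (induction n arbitrary: v)
  case (Suc n)
  then obtain w where "(u, w) \<in> R ^^ n" "(w, v) \<in> R" by auto
  with Suc.IH show ?case by (intro relpow_Suc_I[of _ "f w"]) auto
qed simp

text \<open>Walks are transported forward by \<open>f\<close> and back by its inverse on the
  vertices, so neither distance exceeds the other.\<close>

lemma gdist_map:
  assumes "undirected_tree G" "undirected_tree H" "inj_on f (pverts G)" "pverts H = f ` pverts G"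
    "parcs H = (\<lambda>(u, v). (f u, f v)) ` parcs G" "u \<in> pverts G" "v \<in> pverts G"
  shows "gdist H (f u) (f v) = gdist G u v"
proof -
  interpret G: utree G by unfold_locales fact
  interpret H: utree H by unfold_locales fact
  let ?g = "the_inv_into G.V f"
  have gf: "?g (f y) = y" if "y \<in> G.V" for y using that assms(3) by (simp add: the_inv_into_f_f)
  have "(\<lambda>(u, v). (?g u, ?g v)) ` H.E = (\<lambda>e. e) ` G.E"
    unfolding assms(5) image_image by (rule image_cong) (use gf G.E_in_V in auto)
  then have E: "(\<lambda>(u, v). (?g u, ?g v)) ` H.E = G.E" by simp
  have "H.d (f u) (f v) \<le> G.d u v"
    using relpow_map[OF G.gdist_walk, of u v f] assms by (intro H.gdist_le) auto
  moreover have "G.d u v \<le> H.d (f u) (f v)"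
    using relpow_map[OF H.gdist_walk, of "f u" "f v" ?g] assms E gf by (intro G.gdist_le) auto
  ultimately show ?thesis by simp
qed

lemma tree_iso_invariants:
  assumes "(G, H) \<in> tree_iso"
  shows "card (pverts H) = card (pverts G)" "diameter H = diameter G"
    "wiener_index H = wiener_index G"
proof -
  obtain f where f: "inj_on f (pverts G)" "pverts H = f ` pverts G"
    "parcs H = (\<lambda>(u, v). (f u, f v)) ` parcs G"
    by (rule tree_iso_obtain_map[OF assms])
  have GH: "undirected_tree G" "undirected_tree H" using assms by (auto simp: tree_iso_def)
  interpret G: utree G by unfold_locales fact
  interpret H: utree H by unfold_locales fact
  note gd = gdist_map[OF GH f]
  show "card (pverts H) = card (pverts G)" using f by (simp add: card_image)
  obtain v w where "v \<in> G.V" "w \<in> G.V" "G.d v w = diameter G" by (rule G.diameter_attained)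
  then show "diameter H = diameter G"
    using f(2) gd G.gdist_le_diameter by (intro H.diameter_eqI[of _ "f v" "f w"]) auto
  have "2 * wiener_index H = 2 * wiener_index G"
    unfolding G.twice_wiener_index H.twice_wiener_index f(2)
    using f(1) gd by (simp add: sum.reindex)
  then show "wiener_index H = wiener_index G" by simp
qed

section \<open>Maximal classes and their members\<close>

lemma tree_class_member:
  assumes "A \<in> tree_classes n d" "T \<in> A"
  shows "undirected_tree T" "card (pverts T) = n" "diameter T = d" "A = tree_iso `` {T}"
proof -
  obtain X where X: "card (pverts X) = n" "diameter X = d" "A = tree_iso `` {X}"
    using assms(1) by (auto simp: tree_classes_def quotient_def)
  then have XT: "(X, T) \<in> tree_iso" using assms(2) by simp
  then show "undirected_tree T" "card (pverts T) = n" "diameter T = d"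
    using X tree_iso_invariants[OF XT] by (auto simp: tree_iso_def)
  show "A = tree_iso `` {T}"
    using X(3) XT equiv_tree_iso equiv_class_eq by metis
qed

text \<open>The class of a cover of \<open>T\<close> would equal the class of \<open>T\<close> by
  maximality; but the Wiener index is constant on a class and increases strictly in a
  covering.\<close>

lemma maximal_imp_not_covered:
  assumes "maximal_tree_class n d A" "T \<in> A" "undirected_tree T'"
  shows "\<not> covered_by T T'"
proof
  assume cov: "covered_by T T'"
  have A: "A \<in> tree_classes n d" using assms(1) by (simp add: maximal_tree_class_def)
  note T = tree_class_member[OF A assms(2)]
  let ?B = "tree_iso `` {T'}"
  \<comment> \<open>Both trees are joins of the same \<open>S\<close> and \<open>B\<close>, so they
    have the same vertices.\<close>
  have "card (pverts T') = card (pverts T)" "diameter T' = diameter T"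
    and W: "wiener_index T < wiener_index T'"
    using cov by (auto simp: covered_by_def join_by_edge_def)
  then have B: "?B \<in> tree_classes n d"
    using T assms(3) by (auto simp: tree_classes_def intro: quotientI)
  have T'B: "T' \<in> ?B" using assms(3) equiv_tree_iso by (auto simp: equiv_def refl_on_def)
  have "class_covered_by A ?B" using cov assms(2) T'B by (auto simp: class_covered_by_def)
  then have "tree_class_le n d A ?B"
    using A B by (auto simp: tree_class_le_def)
  then have "?B = A" using assms(1) B by (auto simp: maximal_tree_class_def)
  then have "(T, T') \<in> tree_iso" using T T'B by auto
  then have "wiener_index T' = wiener_index T" by (rule tree_iso_invariants(3))
  with W show False by simp
qed

theorem theorem3p6:
  fixes n d :: nat
    and A :: "'a pair_pre_digraph set"
    and T :: "'a pair_pre_digraph"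
  assumes "n > d" and "d \<ge> 1"
    and "maximal_tree_class n d A" and "T \<in> A"
  shows "\<forall>v. leaf T v \<longrightarrow> gsetdist T (centers T) v = d div 2"
proof (intro allI impI)
  fix h assume h: "leaf T h"
  have "A \<in> tree_classes n d" using assms(3) by (simp add: maximal_tree_class_def)
  note T = tree_class_member[OF this assms(4)]
  interpret utree T by unfold_locales (rule T(1))
  have "diametral T h"
  proof (rule ccontr)
    assume "\<not> diametral T h"
    then obtain u x where ux: "(u, x) \<in> parcs T" "diametral T u" "\<not> diametral T x"
      using nondiametral_boundary h by (metis leaf_def)
    obtain S B c where SB: "undirected_tree S" "undirected_tree B" "pverts S \<inter> pverts B = {}"
      "u \<in> pverts S" "x \<in> pverts B" "T = join_by_edge S u B x" "c \<in> pverts S" "c \<noteq> u"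
      "wiener_index T < wiener_index (join_by_edge S c B x)"
      "diameter (join_by_edge S c B x) = diameter T"
      by (rule covering_move[OF ux])
    have "covered_by T (join_by_edge S c B x)"
      unfolding covered_by_def
      by (intro conjI exI[of _ S] exI[of _ B] exI[of _ c] exI[of _ u] exI[of _ x]) (fact SB refl)+
    moreover have "undirected_tree (join_by_edge S c B x)"
      using SB by (intro undirected_tree_join)
    ultimately show False using maximal_imp_not_covered assms by blast
  qed
  then obtain v w where vw: "v \<in> pverts T" "w \<in> pverts T" "gdist T v w = diameter T"
    "gdist T v h + gdist T h w = diameter T"
    by (auto simp: diametral_def)
  then have "h = v \<or> h = w" using leaf_on_geodesic[OF h] by simp
  \<comment> \<open>If the leaf is \<open>w\<close>, symmetry of the distance exchanges the two
    ends.\<close>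
  then show "gsetdist T (centers T) h = d div 2"
    using gsetdist_centers_diametral vw gdist_sym T(3) by metis
qed

end
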